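(* Let $H$ be a finite dimensional Hilbert space, let $B$ be a unital $C^*$-algebra acting on $H$, and let $\mathrm{Tr}$ denote the usual trace on $B(H)$. Let $P\colon B\to B$ be a projection map which is trace preserving, i.e. $\mathrm{Tr}(P(a))=\mathrm{Tr}(a)$ for all $a\in B$, and suppose that $P(B_{sa})$ is a spin factor of real dimension greater than $6$. Then $P$ is atomic.
   Context: For a unital $C^*$-algebra $B$, $B_{sa}$ denotes its self-adjoint part. A projection map on $B$ is a positive linear map $P\colon B\to B$ with $P(1)=1$ and $P^2=P$. A spin system is a set $(s_i)_{i\in I}$ of symmetries (self-adjoint unitaries) with $s_i\circ s_j=0$ for $i\neq j$, where $a\circ b=\frac12(ab+ba)$. The real linear span of $1$ and the $s_i$ is a Jordan algebra called a spin factor. A linear map $\phi$ between $C^*$-algebras is $2$-positive if $\phi\otimes\iota_2$ is positive, where $\iota_2$ is the identity map on $M_2(\mathbb{C})$; it is $2$-copositive if $\phi\otimes\theta_2$ is positive, where $\theta_2$ is the transpose map on $M_2(\mathbb{C})$. A positive map is atomic if it is not the sum of a 2-positive map and a 2-copositive map (where either summand may be zero). *)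

theory Defs
  imports "HOL-Analysis.Analysis"
begin

text \<open>
  The finite dimensional Hilbert space is \<open>complex ^ 'n\<close> with its standard inner product, and
  operators on it are square matrices. \<open>A *v x\<close>, \<open>A ** B\<close>, \<open>mat 1\<close> and \<open>trace\<close> are those of
  HOL-Analysis; \<open>span\<close> and \<open>dim\<close> are real. The library has no complex scalar multiple of a matrix
  (\<open>*s\<close> at this type would scale by row vectors), no conjugate transpose and no Kronecker product.
\<close>

definition cinner :: "complex ^ 'n \<Rightarrow> complex ^ 'n \<Rightarrow> complex" where
  "cinner x y = (\<Sum>i\<in>UNIV. cnj (x $ i) * y $ i)"

definition cscale :: "complex \<Rightarrow> complex ^ 'n ^ 'm \<Rightarrow> complex ^ 'n ^ 'm" where
  "cscale c A = (\<chi> i j. c * A $ i $ j)"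

definition hadjoint :: "complex ^ 'n ^ 'm \<Rightarrow> complex ^ 'm ^ 'n" where
  "hadjoint A = (\<chi> i j. cnj (A $ j $ i))"

definition selfadjoint :: "complex ^ 'n ^ 'n \<Rightarrow> bool" where
  "selfadjoint A \<longleftrightarrow> hadjoint A = A"

definition positive_op :: "complex ^ 'n ^ 'n \<Rightarrow> bool" where
  "positive_op A \<longleftrightarrow> (\<forall>x. cinner x (A *v x) \<in> \<real>\<^sub>\<ge>\<^sub>0)"

definition unital_cstar_algebra :: "(complex ^ 'n ^ 'n) set \<Rightarrow> bool" where
  "unital_cstar_algebra B \<longleftrightarrow>
     mat 1 \<in> B \<and>
     (\<forall>a\<in>B. \<forall>b\<in>B. a + b \<in> B) \<and>
     (\<forall>c. \<forall>a\<in>B. cscale c a \<in> B) \<and>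
     (\<forall>a\<in>B. \<forall>b\<in>B. a ** b \<in> B) \<and>
     (\<forall>a\<in>B. hadjoint a \<in> B) \<and>
     closed B"

definition sa_part :: "(complex ^ 'n ^ 'n) set \<Rightarrow> (complex ^ 'n ^ 'n) set" where
  "sa_part B = {a \<in> B. selfadjoint a}"

text \<open>
  A map on an algebra is a total function of which only the values on the algebra matter.
\<close>

definition clinear_between ::
    "(complex ^ 'n ^ 'n) set \<Rightarrow> (complex ^ 'm ^ 'm) set \<Rightarrow>
     (complex ^ 'n ^ 'n \<Rightarrow> complex ^ 'm ^ 'm) \<Rightarrow> bool" where
  "clinear_between A C \<phi> \<longleftrightarrow>
     (\<forall>a\<in>A. \<phi> a \<in> C) \<and>
     (\<forall>a\<in>A. \<forall>b\<in>A. \<phi> (a + b) = \<phi> a + \<phi> b) \<and>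
     (\<forall>c. \<forall>a\<in>A. \<phi> (cscale c a) = cscale c (\<phi> a))"

definition positive_map ::
    "(complex ^ 'n ^ 'n) set \<Rightarrow> (complex ^ 'm ^ 'm) set \<Rightarrow>
     (complex ^ 'n ^ 'n \<Rightarrow> complex ^ 'm ^ 'm) \<Rightarrow> bool" where
  "positive_map A C \<phi> \<longleftrightarrow>
     clinear_between A C \<phi> \<and> (\<forall>a\<in>A. positive_op a \<longrightarrow> positive_op (\<phi> a))"

definition projection_map ::
    "(complex ^ 'n ^ 'n) set \<Rightarrow> (complex ^ 'n ^ 'n \<Rightarrow> complex ^ 'n ^ 'n) \<Rightarrow> bool" where
  "projection_map B P \<longleftrightarrow>
     positive_map B B P \<and> P (mat 1) = mat 1 \<and> (\<forall>a\<in>B. P (P a) = P a)"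

definition jordan_prod :: "complex ^ 'n ^ 'n \<Rightarrow> complex ^ 'n ^ 'n \<Rightarrow> complex ^ 'n ^ 'n" where
  "jordan_prod a b = (1/2) *\<^sub>R (a ** b + b ** a)"

definition symmetry :: "complex ^ 'n ^ 'n \<Rightarrow> bool" where
  "symmetry s \<longleftrightarrow> selfadjoint s \<and> hadjoint s ** s = mat 1 \<and> s ** hadjoint s = mat 1"

definition spin_system :: "(complex ^ 'n ^ 'n) set \<Rightarrow> bool" where
  "spin_system S \<longleftrightarrow>
     (\<forall>s\<in>S. symmetry s) \<and> (\<forall>s\<in>S. \<forall>t\<in>S. s \<noteq> t \<longrightarrow> jordan_prod s t = 0)"

definition spin_factor :: "(complex ^ 'n ^ 'n) set \<Rightarrow> bool" where
  "spin_factor V \<longleftrightarrow> (\<exists>S. spin_system S \<and> V = span (insert (mat 1) S))"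

definition kron ::
    "complex ^ 'n ^ 'n \<Rightarrow> complex ^ 'k ^ 'k \<Rightarrow>
     complex ^ ('n::finite \<times> 'k::finite) ^ ('n::finite \<times> 'k::finite)" where
  "kron a m = (\<chi> p q. a $ fst p $ fst q * m $ snd p $ snd q)"

definition matrix_unit :: "'k \<Rightarrow> 'k \<Rightarrow> complex ^ 'k ^ 'k" where
  "matrix_unit i j = (\<chi> r s. if r = i \<and> s = j then 1 else 0)"

definition block ::
    "complex ^ ('n::finite \<times> 'k::finite) ^ ('n::finite \<times> 'k::finite) \<Rightarrow>
     'k \<Rightarrow> 'k \<Rightarrow> complex ^ 'n ^ 'n" where
  "block X i j = (\<chi> r s. X $ (r, i) $ (s, j))"

text \<open>
  Every \<open>X\<close> on \<open>H \<otimes> \<complex>\<^sup>k\<close> equals \<open>\<Sum>i j. kron (block X i j) (matrix_unit i j)\<close>. Hence the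
  tensor product of \<open>A\<close> with the full matrix algebra consists of the \<open>X\<close> with all blocks in \<open>A\<close>,
  and \<open>tensor_map \<phi> \<theta>\<close> is the linear map sending \<open>kron a m\<close> to \<open>kron (\<phi> a) (\<theta> m)\<close>.
\<close>

definition matrices_over ::
    "(complex ^ 'n ^ 'n) set \<Rightarrow> (complex ^ ('n::finite \<times> 'k::finite) ^ ('n::finite \<times> 'k::finite)) set" where
  "matrices_over A = {X. \<forall>i j. block X i j \<in> A}"

definition tensor_map ::
    "(complex ^ 'n ^ 'n \<Rightarrow> complex ^ 'm ^ 'm) \<Rightarrow> (complex ^ 'k ^ 'k \<Rightarrow> complex ^ 'k ^ 'k) \<Rightarrow>
     complex ^ ('n::finite \<times> 'k::finite) ^ ('n::finite \<times> 'k::finite) \<Rightarrow>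
     complex ^ ('m::finite \<times> 'k::finite) ^ ('m::finite \<times> 'k::finite)" where
  "tensor_map \<phi> \<theta> X =
     (\<Sum>i\<in>UNIV. \<Sum>j\<in>UNIV. kron (\<phi> (block X i j)) (\<theta> (matrix_unit i j)))"

definition two_positive ::
    "(complex ^ 'n ^ 'n) set \<Rightarrow> (complex ^ 'm ^ 'm) set \<Rightarrow>
     (complex ^ 'n ^ 'n \<Rightarrow> complex ^ 'm ^ 'm) \<Rightarrow> bool" where
  "two_positive A C \<phi> \<longleftrightarrow>
     clinear_between A C \<phi> \<and>
     positive_map (matrices_over A) (matrices_over C)
       (tensor_map \<phi> (id :: complex ^ 2 ^ 2 \<Rightarrow> complex ^ 2 ^ 2))"

definition two_copositive ::
    "(complex ^ 'n ^ 'n) set \<Rightarrow> (complex ^ 'm ^ 'm) set \<Rightarrow>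
     (complex ^ 'n ^ 'n \<Rightarrow> complex ^ 'm ^ 'm) \<Rightarrow> bool" where
  "two_copositive A C \<phi> \<longleftrightarrow>
     clinear_between A C \<phi> \<and>
     positive_map (matrices_over A) (matrices_over C)
       (tensor_map \<phi> (transpose :: complex ^ 2 ^ 2 \<Rightarrow> complex ^ 2 ^ 2))"

definition atomic_map ::
    "(complex ^ 'n ^ 'n) set \<Rightarrow> (complex ^ 'm ^ 'm) set \<Rightarrow>
     (complex ^ 'n ^ 'n \<Rightarrow> complex ^ 'm ^ 'm) \<Rightarrow> bool" where
  "atomic_map A C \<phi> \<longleftrightarrow>
     positive_map A C \<phi> \<and>
     \<not> (\<exists>\<phi>\<^sub>1 \<phi>\<^sub>2. two_positive A C \<phi>\<^sub>1 \<and> two_copositive A C \<phi>\<^sub>2 \<and>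
          (\<forall>a\<in>A. \<phi> a = \<phi>\<^sub>1 a + \<phi>\<^sub>2 a))"

end

theory Submission imports Defs begin

text \<open>
  Write \<open>P = \<phi> + \<psi>\<close> with \<open>\<phi>\<close> 2-positive and \<open>\<psi>\<close> 2-copositive, and let \<open>s\<close> be a symmetry of the
  spin system with spectral projection \<open>e = (1 + s)/2\<close>. Both summands are positive and \<open>P e = e\<close>,
  so \<open>\<phi> e \<le> e\<close> and \<open>\<psi> e \<le> e\<close>, and likewise for \<open>1 - e\<close>. The Cauchy-Schwarz inequality of a
  2-positive map then turns \<open>\<phi>\<close> into a left module map over \<open>s\<close>, and that of a 2-copositive map
  turns \<open>\<psi>\<close> into an antimodule map: \<open>\<phi> (s x) = s \<phi> x\<close> and \<open>\<psi> (x s) = s \<psi> x\<close> for all \<open>x\<close>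
  (\<open>decomposition_symmetry_module\<close>). Hence, for members \<open>s1, ..., s4\<close> of the spin system and
  \<open>w = s1 s2 s3 s4\<close>,

    \<open>P w = s1 s2 s3 s4 (\<phi> 1) + s4 s3 s2 s1 (\<psi> 1) = w (\<phi> 1 + \<psi> 1) = w\<close>,

  because reversing four anticommuting factors takes six transpositions and so does not change the
  product.

  On the other hand \<open>P\<close> respects the trace pairing with the spin factor,
  \<open>Tr (P x s) = Tr (x s)\<close> (\<open>trace_fixed_symmetry\<close>), so that \<open>P w = 0\<close> as soon as \<open>w\<close> is trace
  orthogonal to 1 and to every \<open>t\<close> in the spin system (\<open>spin_system_four_product_trace\<close>). If \<open>t\<close> is
  one of the four factors, \<open>t\<close> itself anticommutes with \<open>w t\<close>. Otherwise a further symmetry \<open>u\<close> is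
  needed: it commutes with \<open>w\<close> and anticommutes with \<open>t\<close>. This takes six symmetries, which is what
  dimension greater than 6 provides. As \<open>w\<close> is invertible, \<open>P w = w\<close> and \<open>P w = 0\<close> contradict
  each other.
\<close>

section \<open>Matrix algebra\<close>

lemma hadjoint_mult: "hadjoint (A ** B) = hadjoint B ** hadjoint A"
  by (simp add: hadjoint_def matrix_matrix_mult_def vec_eq_iff mult.commute)

lemma hadjoint_add: "hadjoint (A + B) = hadjoint A + hadjoint B"
  by (simp add: hadjoint_def vec_eq_iff)

lemma hadjoint_diff: "hadjoint (A - B) = hadjoint A - hadjoint B"
  by (simp add: hadjoint_def vec_eq_iff)

lemma hadjoint_cscale: "hadjoint (cscale c A) = cscale (cnj c) (hadjoint A)"
  by (simp add: hadjoint_def cscale_def vec_eq_iff)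

lemma hadjoint_hadjoint: "hadjoint (hadjoint A) = A"
  by (simp add: hadjoint_def vec_eq_iff)

lemma hadjoint_mat_1: "hadjoint (mat 1 :: complex ^ 'n ^ 'n) = mat 1"
  by (simp add: hadjoint_def mat_def vec_eq_iff)

lemma cscale_mult_left: "cscale c A ** B = cscale c (A ** B)"
  by (simp add: cscale_def matrix_matrix_mult_def vec_eq_iff sum_distrib_left mult.assoc)

lemma cscale_mult_right: "A ** cscale c B = cscale c (A ** B)"
  by (simp add: cscale_def matrix_matrix_mult_def vec_eq_iff sum_distrib_left mult_ac)

lemma cscale_cscale: "cscale c (cscale d A) = cscale (c * d) A"
  by (simp add: cscale_def vec_eq_iff mult.assoc)

lemma cscale_add: "cscale c (A + B) = cscale c A + cscale c B"
  by (simp add: cscale_def vec_eq_iff distrib_left)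

lemma cscale_1: "cscale 1 A = A"
  by (simp add: cscale_def vec_eq_iff)

lemma cscale_of_real: "cscale (complex_of_real r) A = r *\<^sub>R A"
  unfolding cscale_def vec_eq_iff vector_scaleR_component vec_lambda_beta
  by (simp add: scaleR_conv_of_real)

lemma minus_eq_cscale: "- A = cscale (- 1) A"
  by (simp add: cscale_def vec_eq_iff)

lemma trace_cscale: "trace (cscale c A) = c * trace A"
  by (simp add: cscale_def trace_def sum_distrib_left)

lemma trace_zero: "trace (0 :: complex ^ 'n ^ 'n) = 0"
  by (simp add: trace_def)

lemma matrix_add_rdistrib:
  fixes A B :: "complex ^ 'n ^ 'm" shows "(A + B) ** C = A ** C + B ** C"
  by (simp add: matrix_matrix_mult_def vec_eq_iff sum.distrib distrib_right)

lemma matrix_diff_rdistrib: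
  fixes A B :: "complex ^ 'n ^ 'm" shows "(A - B) ** C = A ** C - B ** C"
  by (simp add: matrix_matrix_mult_def vec_eq_iff sum_subtractf left_diff_distrib)

lemma matrix_diff_ldistrib:
  fixes A :: "complex ^ 'n ^ 'm" shows "A ** (B - C) = A ** B - A ** C"
  by (simp add: matrix_matrix_mult_def vec_eq_iff sum_subtractf right_diff_distrib)

lemma scaleR_matrix_mult_left:
  fixes A :: "complex ^ 'n ^ 'm" shows "(r *\<^sub>R A) ** B = r *\<^sub>R (A ** B)"
  by (simp flip: cscale_of_real add: cscale_mult_left)

lemma scaleR_matrix_mult_right:
  fixes A :: "complex ^ 'n ^ 'm" shows "A ** (r *\<^sub>R B) = r *\<^sub>R (A ** B)"
  by (simp flip: cscale_of_real add: cscale_mult_right)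

lemma cscale_matrix_vector: "cscale c A *v x = c *s (A *v x)"
  by (simp add: cscale_def matrix_vector_mult_def vec_eq_iff sum_distrib_left mult.assoc)

lemma cinner_add_left: "cinner (x + y) z = cinner x z + cinner y z"
  by (simp add: cinner_def distrib_right sum.distrib)

lemma cinner_add_right: "cinner x (y + z) = cinner x y + cinner x z"
  by (simp add: cinner_def distrib_left sum.distrib)

lemma cinner_scale_right: "cinner x (c *s y) = c * cinner x y"
  by (simp add: cinner_def sum_distrib_left mult_ac)

lemma cinner_adjoint: "cinner x (A *v y) = cinner (hadjoint A *v x) y"
proof -
  have "cinner x (A *v y) = (\<Sum>i\<in>UNIV. \<Sum>j\<in>UNIV. cnj (x $ i) * A $ i $ j * y $ j)"
    by (simp add: cinner_def matrix_vector_mult_def sum_distrib_left mult_ac)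
  also have "\<dots> = (\<Sum>j\<in>UNIV. \<Sum>i\<in>UNIV. cnj (x $ i) * A $ i $ j * y $ j)"
    by (rule sum.swap)
  also have "\<dots> = cinner (hadjoint A *v x) y"
    by (simp add: cinner_def matrix_vector_mult_def hadjoint_def sum_distrib_right
        mult.commute[of "A $ _ $ _"])
  finally show ?thesis .
qed

lemma sum_in_nonneg_Reals:
  fixes f :: "'a \<Rightarrow> complex"
  assumes "\<And>i. i \<in> I \<Longrightarrow> f i \<in> \<real>\<^sub>\<ge>\<^sub>0"
  shows "sum f I \<in> \<real>\<^sub>\<ge>\<^sub>0"
  using assms by (induction I rule: infinite_finite_induct) auto

lemma cinner_self_nonneg: "cinner x x \<in> \<real>\<^sub>\<ge>\<^sub>0"
  unfolding cinner_def
  by (intro sum_in_nonneg_Reals) (simp add: complex_nonneg_Reals_iff)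

lemma cinner_self_eq_0: "cinner x x = 0 \<Longrightarrow> x = 0"
proof -
  assume "cinner x x = 0"
  hence "(\<Sum>i\<in>UNIV. (cmod (x $ i))\<^sup>2) = 0"
    unfolding cinner_def
    by (simp add: mult.commute[of "cnj _"] complex_norm_square[symmetric]
        flip: of_real_sum of_real_power)
  thus "x = 0"
    by (simp add: sum_nonneg_eq_0_iff vec_eq_iff)
qed

lemma matrix_eq_0_if_cinner_eq_0:
  fixes A :: "complex ^ 'n ^ 'm"
  assumes "\<And>x y. cinner x (A *v y) = 0" shows "A = 0"
proof -
  have "A *v y = 0 *v y" for y
    using cinner_self_eq_0[OF assms[of "A *v y" y]] by simp
  thus ?thesis by (simp add: matrix_eq)
qed

lemma positive_gram: "positive_op (hadjoint A ** A)"
  unfolding positive_op_def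
  by (metis cinner_adjoint cinner_self_nonneg hadjoint_hadjoint matrix_vector_mul_assoc)

lemma trace_gram_eq_0:
  fixes A :: "complex ^ 'n ^ 'n"
  assumes "trace (hadjoint A ** A) = 0" shows "A = 0"
proof -
  have "(\<Sum>i\<in>UNIV. \<Sum>j\<in>UNIV. (cmod (A $ j $ i))\<^sup>2) = 0"
    using assms
    by (simp add: trace_def hadjoint_def matrix_matrix_mult_def mult.commute[of "cnj _"]
        complex_norm_square[symmetric] flip: of_real_sum of_real_power)
  thus ?thesis
    by (simp add: sum_nonneg_eq_0_iff sum_nonneg vec_eq_iff)
qed

lemma trace_compression_nonneg:
  assumes "positive_op A"
  shows "trace (hadjoint E ** A ** E) \<in> \<real>\<^sub>\<ge>\<^sub>0"
proof -
  have "(hadjoint E ** A ** E) $ i $ i = cinner (column i E) (A *v column i E)" for i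
    unfolding matrix_mul_assoc[symmetric]
    by (simp add: cinner_def column_def hadjoint_def matrix_vector_mult_def matrix_matrix_mult_def)
  thus ?thesis
    using assms unfolding trace_def positive_op_def
    by (auto intro!: sum_in_nonneg_Reals)
qed

section \<open>Degenerate sesquilinear forms\<close>

lemma affine_nonneg_imp_0:
  fixes u r :: complex
  assumes "\<And>t::real. of_real t * u + r \<in> \<real>\<^sub>\<ge>\<^sub>0"
  shows "u = 0"
proof -
  have re: "t * Re u + Re r \<ge> 0" and im: "t * Im u + Im r = 0" for t
    using assms[of t] by (auto simp: complex_nonneg_Reals_iff)
  have "Im u = 0" using im[of 0] im[of 1] by simp
  moreover have "Re u = 0"
  proof (rule ccontr)
    assume "Re u \<noteq> 0"
    thus False using re[of "- (Re r + 1) / Re u"] by simp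
  qed
  ultimately show ?thesis by (simp add: complex_eq_iff)
qed

text \<open>
  Every use of Cauchy-Schwarz below has one argument \<open>q\<close> on which the quadratic form vanishes.
  Expanding the form at \<open>c q + x\<close> gives the left-hand side here, with no term in \<open>\<bar>c\<bar>\<^sup>2\<close>; being
  affine in \<open>c\<close>, it cannot stay nonnegative unless the cross terms vanish.
\<close>

lemma sesquilinear_nonneg_imp_0:
  fixes w z r :: complex
  assumes "\<And>c. c * w + cnj c * z + r \<in> \<real>\<^sub>\<ge>\<^sub>0"
  shows "z = 0"
proof -
  have "w + z = 0"
    using assms[of "of_real t" for t]
    by (intro affine_nonneg_imp_0[of _ r]) (simp add: distrib_left)
  moreover have "\<i> * (w - z) = 0"
    using assms[of "of_real t * \<i>" for t]
    by (intro affine_nonneg_imp_0[of _ r]) (simp add: algebra_simps)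
  ultimately show ?thesis by simp
qed

section \<open>Cauchy-Schwarz for 2-positive and 2-copositive maps\<close>

lemma block_tensor_map_id: "block (tensor_map \<phi> id X) i j = \<phi> (block X i j)"
proof -
  have "(\<Sum>k\<in>UNIV. \<Sum>l\<in>UNIV. \<phi> (block X k l) $ r $ s * (if i = k \<and> j = l then 1 else 0))
      = (\<Sum>k\<in>UNIV. if i = k then \<Sum>l\<in>UNIV. if j = l then \<phi> (block X k l) $ r $ s else 0 else 0)"
    for r s
    by (intro sum.cong refl) (simp add: if_distrib[of "(*) _"] cong: if_cong)
  thus ?thesis
    by (simp add: block_def tensor_map_def kron_def matrix_unit_def vec_eq_iff)
qed

lemma block_tensor_map_transpose: "block (tensor_map \<phi> transpose X) i j = \<phi> (block X j i)"
proof -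
  have "(\<Sum>k\<in>UNIV. \<Sum>l\<in>UNIV. \<phi> (block X k l) $ r $ s * (if j = k \<and> i = l then 1 else 0))
      = (\<Sum>k\<in>UNIV. if j = k then \<Sum>l\<in>UNIV. if i = l then \<phi> (block X k l) $ r $ s else 0 else 0)"
    for r s
    by (intro sum.cong refl) (simp add: if_distrib[of "(*) _"] cong: if_cong)
  thus ?thesis
    by (simp add: block_def tensor_map_def kron_def matrix_unit_def transpose_def vec_eq_iff)
qed

definition slice :: "complex ^ ('n::finite \<times> 'k::finite) \<Rightarrow> 'k \<Rightarrow> complex ^ 'n" where
  "slice v i = (\<chi> r. v $ (r, i))"

lemma cinner_blocks:
  "cinner v (Y *v v) = (\<Sum>i\<in>UNIV. \<Sum>j\<in>UNIV. cinner (slice v i) (block Y i j *v slice v j))"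
proof -
  have split: "(\<Sum>p\<in>UNIV. g p) = (\<Sum>i\<in>UNIV. \<Sum>r\<in>UNIV. g (r, i))" for g :: "'a \<times> 'b \<Rightarrow> complex"
    by (subst sum.swap) (simp add: sum.cartesian_product flip: UNIV_Times_UNIV)
  have "cinner v (Y *v v) = (\<Sum>i\<in>UNIV. \<Sum>r\<in>UNIV. \<Sum>j\<in>UNIV. \<Sum>s\<in>UNIV.
      cnj (v $ (r, i)) * Y $ (r, i) $ (s, j) * v $ (s, j))"
    by (simp add: cinner_def matrix_vector_mult_def split sum_distrib_left mult.assoc)
  also have "\<dots> = (\<Sum>i\<in>UNIV. \<Sum>j\<in>UNIV. \<Sum>r\<in>UNIV. \<Sum>s\<in>UNIV.
      cnj (v $ (r, i)) * Y $ (r, i) $ (s, j) * v $ (s, j))"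
    by (intro sum.cong refl sum.swap)
  also have "\<dots> = (\<Sum>i\<in>UNIV. \<Sum>j\<in>UNIV. cinner (slice v i) (block Y i j *v slice v j))"
    by (simp add: cinner_def matrix_vector_mult_def slice_def block_def sum_distrib_left mult.assoc)
  finally show ?thesis .
qed

text \<open>
  Common source of the two inequalities below. The block matrix \<open>X\<close> with blocks
  \<open>c\<^sub>i\<^sup>* c\<^sub>j\<close>, where \<open>c\<^sub>1 = a\<close> and \<open>c\<^sub>2 = b\<close>, is positive, since
  its quadratic form at \<open>u\<close> is the squared norm of \<open>c\<^sub>1 u\<^sub>1 + c\<^sub>2 u\<^sub>2\<close>. The parameter \<open>G\<close> records how
  \<open>\<Phi>\<close> acts on blocks: with or without exchanging the two indices.
\<close>

lemma two_gram_nonneg: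
  fixes a b :: "complex ^ 'n ^ 'n" and \<xi> \<eta> :: "complex ^ 'm"
  assumes "\<And>X :: complex ^ ('n \<times> 2) ^ ('n \<times> 2).
      (\<And>i j. block X i j \<in> B) \<Longrightarrow> positive_op X \<Longrightarrow> positive_op (\<Phi> X :: complex ^ ('m \<times> 2) ^ ('m \<times> 2))"
    and "\<And>X i j. block (\<Phi> X) i j = G (block X) i j"
    and "unital_cstar_algebra B" "a \<in> B" "b \<in> B"
  defines "D \<equiv> \<lambda>i j. hadjoint (if i = 1 then a else b) ** (if j = 1 then a else b)"
  shows "cinner \<xi> (G D 1 1 *v \<xi>) + cinner \<xi> (G D 1 2 *v \<eta>) +
    cinner \<eta> (G D 2 1 *v \<xi>) + cinner \<eta> (G D 2 2 *v \<eta>) \<in> \<real>\<^sub>\<ge>\<^sub>0"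
proof -
  define c :: "2 \<Rightarrow> complex ^ 'n ^ 'n" where "c i = (if i = 1 then a else b)" for i
  define X :: "complex ^ ('n \<times> 2) ^ ('n \<times> 2)" where
    "X = (\<chi> p q. (hadjoint (c (snd p)) ** c (snd q)) $ fst p $ fst q)"
  define v :: "complex ^ ('m \<times> 2)" where
    "v = (\<chi> p. (if snd p = 1 then \<xi> else \<eta>) $ fst p)"
  have blockX: "block X = D"
    by (simp add: fun_eq_iff vec_eq_iff block_def X_def D_def c_def)
  have "positive_op X"
    unfolding positive_op_def
  proof
    fix u
    have "cinner u (X *v u) =
        cinner (\<Sum>i\<in>UNIV. c i *v slice u i) (\<Sum>j\<in>UNIV. c j *v slice u j)"
      by (simp add: cinner_blocks blockX D_def sum_2 c_def cinner_add_left cinner_add_right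
          cinner_adjoint[of _ "hadjoint _"] hadjoint_hadjoint flip: matrix_vector_mul_assoc)
    thus "cinner u (X *v u) \<in> \<real>\<^sub>\<ge>\<^sub>0"
      by (simp add: cinner_self_nonneg)
  qed
  moreover have "block X i j \<in> B" for i j
    using assms(3-5) by (simp add: blockX D_def unital_cstar_algebra_def)
  ultimately have "cinner v (\<Phi> X *v v) \<in> \<real>\<^sub>\<ge>\<^sub>0"
    using assms(1) positive_op_def by blast
  moreover have "slice v 1 = \<xi>" "slice v 2 = \<eta>"
    by (simp_all add: slice_def v_def vec_eq_iff)
  ultimately show ?thesis
    by (simp add: cinner_blocks assms(2) blockX sum_2 add.assoc)
qed

lemma two_positive_ineq:
  assumes "unital_cstar_algebra B" "two_positive B C \<phi>" "a \<in> B" "b \<in> B"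
  shows "cinner \<xi> (\<phi> (hadjoint a ** a) *v \<xi>) + cinner \<xi> (\<phi> (hadjoint a ** b) *v \<eta>) +
    cinner \<eta> (\<phi> (hadjoint b ** a) *v \<xi>) + cinner \<eta> (\<phi> (hadjoint b ** b) *v \<eta>) \<in> \<real>\<^sub>\<ge>\<^sub>0"
proof -
  have "positive_op (tensor_map \<phi> id X)"
    if "\<And>i j. block X i j \<in> B" "positive_op X" for X :: "complex ^ ('a \<times> 2) ^ ('a \<times> 2)"
    using assms(2) that by (simp add: two_positive_def positive_map_def matrices_over_def)
  from two_gram_nonneg[of B "tensor_map \<phi> id" "\<lambda>D i j. \<phi> (D i j)", OF this block_tensor_map_id
      assms(1,3,4), of \<xi> \<eta>]
  show ?thesis by simp
qed

lemma two_copositive_ineq: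
  assumes "unital_cstar_algebra B" "two_copositive B C \<phi>" "a \<in> B" "b \<in> B"
  shows "cinner \<xi> (\<phi> (hadjoint a ** a) *v \<xi>) + cinner \<xi> (\<phi> (hadjoint b ** a) *v \<eta>) +
    cinner \<eta> (\<phi> (hadjoint a ** b) *v \<xi>) + cinner \<eta> (\<phi> (hadjoint b ** b) *v \<eta>) \<in> \<real>\<^sub>\<ge>\<^sub>0"
proof -
  have "positive_op (tensor_map \<phi> transpose X)"
    if "\<And>i j. block X i j \<in> B" "positive_op X" for X :: "complex ^ ('a \<times> 2) ^ ('a \<times> 2)"
    using assms(2) that by (simp add: two_copositive_def positive_map_def matrices_over_def)
  from two_gram_nonneg[of B "tensor_map \<phi> transpose" "\<lambda>D i j. \<phi> (D j i)", OF this
      block_tensor_map_transpose assms(1,3,4), of \<xi> \<eta>]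
  show ?thesis by simp
qed

section \<open>Module properties of the summands\<close>

definition projection :: "complex ^ 'n ^ 'n \<Rightarrow> bool" where
  "projection e \<longleftrightarrow> hadjoint e = e \<and> e ** e = e"

text \<open>
  If \<open>\<xi>\<close> is a null vector of the form of \<open>\<phi> e\<close>, then \<open>(e, \<xi>)\<close> is null for the positive
  sesquilinear form on pairs given by the 2-by-2 inequality, hence orthogonal to every \<open>(x, \<eta>)\<close>.
\<close>

lemma two_positive_annihilates:
  assumes "unital_cstar_algebra B" "two_positive B C \<phi>" "e \<in> B" "projection e" "x \<in> B"
    and null: "cinner \<xi> (\<phi> e *v \<xi>) = 0"
  shows "cinner \<xi> (\<phi> (e ** x) *v \<eta>) = 0"
proof (rule sesquilinear_nonneg_imp_0)
  fix c
  have mem: "cscale c e \<in> B" "e ** x \<in> B" "hadjoint x ** e \<in> B"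
    using assms(1,3,5) by (simp_all add: unital_cstar_algebra_def)
  have hom: "\<phi> (cscale d y) = cscale d (\<phi> y)" if "y \<in> B" for d y
    using assms(2) that by (simp add: two_positive_def clinear_between_def)
  show "c * cinner \<eta> (\<phi> (hadjoint x ** e) *v \<xi>) + cnj c * cinner \<xi> (\<phi> (e ** x) *v \<eta>)
      + cinner \<eta> (\<phi> (hadjoint x ** x) *v \<eta>) \<in> \<real>\<^sub>\<ge>\<^sub>0"
    using two_positive_ineq[OF assms(1,2) mem(1) assms(5), of \<xi> \<eta>] assms(3,4) null mem
    by (simp add: projection_def hadjoint_cscale cscale_mult_left cscale_mult_right cscale_cscale
        hom cscale_matrix_vector cinner_scale_right add_ac)
qed

lemma two_copositive_annihilates:
  assumes "unital_cstar_algebra B" "two_copositive B C \<phi>" "e \<in> B" "projection e" "x \<in> B"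
    and null: "cinner \<xi> (\<phi> e *v \<xi>) = 0"
  shows "cinner \<xi> (\<phi> (x ** e) *v \<eta>) = 0"
proof (rule sesquilinear_nonneg_imp_0)
  fix c
  have mem: "cscale (cnj c) e \<in> B" "x ** e \<in> B" "e ** hadjoint x \<in> B" "hadjoint x \<in> B"
    using assms(1,3,5) by (simp_all add: unital_cstar_algebra_def)
  have hom: "\<phi> (cscale d y) = cscale d (\<phi> y)" if "y \<in> B" for d y
    using assms(2) that by (simp add: two_copositive_def clinear_between_def)
  show "c * cinner \<eta> (\<phi> (e ** hadjoint x) *v \<xi>) + cnj c * cinner \<xi> (\<phi> (x ** e) *v \<eta>)
      + cinner \<eta> (\<phi> (x ** hadjoint x) *v \<eta>) \<in> \<real>\<^sub>\<ge>\<^sub>0"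
    using two_copositive_ineq[OF assms(1,2) mem(1,4), of \<xi> \<eta>] assms(3,4) null mem
    by (simp add: projection_def hadjoint_cscale cscale_mult_left cscale_mult_right cscale_cscale
        hom cscale_matrix_vector cinner_scale_right hadjoint_hadjoint add_ac)
qed


lemma projection_complement: "projection e \<Longrightarrow> projection (mat 1 - e)"
  by (simp add: projection_def hadjoint_diff hadjoint_mat_1 matrix_diff_rdistrib
      matrix_diff_ldistrib)

lemma projection_mult_complement: "projection e \<Longrightarrow> e ** (mat 1 - e) = 0"
  by (simp add: projection_def matrix_diff_ldistrib)

lemma mult_eq_0_if_cinner_eq_0:
  assumes "projection p" "\<And>x y. cinner (p *v x) (u *v y) = 0"
  shows "p ** u = 0"
proof (rule matrix_eq_0_if_cinner_eq_0)
  show "cinner x ((p ** u) *v y) = 0" for x y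
    using assms cinner_adjoint[of x p "u *v y"]
    by (simp add: projection_def flip: matrix_vector_mul_assoc)
qed

text \<open>
  For a projection, \<open>u\<close> has range under \<open>e\<close> and \<open>v\<close> has range under \<open>1 - e\<close>; so multiplying
  \<open>u + v\<close> by \<open>e\<close> extracts \<open>u\<close>. Applied with \<open>u = \<phi> (e x)\<close> and \<open>v = \<phi> ((1 - e) x)\<close>, this is
  how null vectors yield the module property.
\<close>

lemma projection_mult_sum:
  assumes "projection e"
    and u: "\<And>x y. cinner ((mat 1 - e) *v x) (u *v y) = 0"
    and v: "\<And>x y. cinner (e *v x) (v *v y) = 0"
  shows "e ** (u + v) = u"
  using mult_eq_0_if_cinner_eq_0[OF projection_complement[OF assms(1)] u]
    mult_eq_0_if_cinner_eq_0[OF assms(1) v]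
  by (simp add: matrix_add_ldistrib matrix_diff_rdistrib)

lemma cstar_diff: "unital_cstar_algebra B \<Longrightarrow> a \<in> B \<Longrightarrow> b \<in> B \<Longrightarrow> a - b \<in> B"
  using minus_eq_cscale[of b] unfolding unital_cstar_algebra_def
  by (metis add_uminus_conv_diff)

lemma cstar_scaleR: "unital_cstar_algebra B \<Longrightarrow> a \<in> B \<Longrightarrow> r *\<^sub>R a \<in> B"
  using cscale_of_real[of r a] unfolding unital_cstar_algebra_def by metis

lemma clinear_scaleR: "clinear_between B C \<phi> \<Longrightarrow> a \<in> B \<Longrightarrow> \<phi> (r *\<^sub>R a) = r *\<^sub>R \<phi> a"
  by (simp add: clinear_between_def flip: cscale_of_real)

lemma clinear_diff:
  assumes "unital_cstar_algebra B" "clinear_between B C \<phi>" "a \<in> B" "b \<in> B"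
  shows "\<phi> (a - b) = \<phi> a - \<phi> b"
  using assms clinear_scaleR[OF assms(2,4), of "-1"] cstar_scaleR[OF assms(1,4), of "-1"]
  unfolding clinear_between_def by (metis add_uminus_conv_diff scaleR_minus1_left)

lemma two_positive_left_module:
  assumes "unital_cstar_algebra B" "two_positive B C \<phi>" "e \<in> B" "projection e" "x \<in> B"
    and null: "\<And>q \<xi>. q \<in> {e, mat 1 - e} \<Longrightarrow>
      cinner ((mat 1 - q) *v \<xi>) (\<phi> q *v ((mat 1 - q) *v \<xi>)) = 0"
  shows "\<phi> (e ** x) = e ** \<phi> x"
proof -
  have mem: "mat 1 - e \<in> B" "e ** x \<in> B" "(mat 1 - e) ** x \<in> B"
    using assms(1,3,5) cstar_diff[OF assms(1)] by (simp_all add: unital_cstar_algebra_def)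
  have "e ** (\<phi> (e ** x) + \<phi> ((mat 1 - e) ** x)) = \<phi> (e ** x)"
    using null[of "mat 1 - e"]
    by (intro projection_mult_sum assms two_positive_annihilates[OF assms(1,2)]
        projection_complement mem null) auto
  moreover have "\<phi> (e ** x) + \<phi> ((mat 1 - e) ** x) = \<phi> (e ** x + (mat 1 - e) ** x)"
    using assms(2) mem by (simp add: two_positive_def clinear_between_def)
  ultimately show ?thesis by (simp add: matrix_diff_rdistrib)
qed

lemma two_copositive_left_module:
  assumes "unital_cstar_algebra B" "two_copositive B C \<phi>" "e \<in> B" "projection e" "x \<in> B"
    and null: "\<And>q \<xi>. q \<in> {e, mat 1 - e} \<Longrightarrow>
      cinner ((mat 1 - q) *v \<xi>) (\<phi> q *v ((mat 1 - q) *v \<xi>)) = 0"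
  shows "\<phi> (x ** e) = e ** \<phi> x"
proof -
  have mem: "mat 1 - e \<in> B" "x ** e \<in> B" "x ** (mat 1 - e) \<in> B"
    using assms(1,3,5) cstar_diff[OF assms(1)] by (simp_all add: unital_cstar_algebra_def)
  have "e ** (\<phi> (x ** e) + \<phi> (x ** (mat 1 - e))) = \<phi> (x ** e)"
    using null[of "mat 1 - e"]
    by (intro projection_mult_sum assms two_copositive_annihilates[OF assms(1,2)]
        projection_complement mem null) auto
  moreover have "\<phi> (x ** e) + \<phi> (x ** (mat 1 - e)) = \<phi> (x ** e + x ** (mat 1 - e))"
    using assms(2) mem by (simp add: two_copositive_def clinear_between_def)
  ultimately show ?thesis by (simp add: matrix_diff_ldistrib)
qed

lemma two_positive_projection_nonneg:
  assumes "unital_cstar_algebra B" "two_positive B C \<phi>" "q \<in> B" "projection q"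
  shows "cinner \<xi> (\<phi> q *v \<xi>) \<in> \<real>\<^sub>\<ge>\<^sub>0"
  using two_positive_ineq[OF assms(1,2,3,3), of \<xi> 0] assms(4)
  by (simp add: projection_def cinner_def)

lemma two_copositive_projection_nonneg:
  assumes "unital_cstar_algebra B" "two_copositive B C \<phi>" "q \<in> B" "projection q"
  shows "cinner \<xi> (\<phi> q *v \<xi>) \<in> \<real>\<^sub>\<ge>\<^sub>0"
  using two_copositive_ineq[OF assms(1,2,3,3), of \<xi> 0] assms(4)
  by (simp add: projection_def cinner_def)

lemma nonneg_Reals_add_eq_0:
  "a \<in> \<real>\<^sub>\<ge>\<^sub>0 \<Longrightarrow> b \<in> \<real>\<^sub>\<ge>\<^sub>0 \<Longrightarrow> a + b = 0 \<Longrightarrow> a = 0 \<and> b = (0::complex)"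
  by (auto simp: complex_nonneg_Reals_iff complex_eq_iff)

text \<open>
  The inequalities \<open>0 \<le> \<phi> q \<le> q\<close> and \<open>0 \<le> \<psi> q \<le> q\<close> in the only form needed: both forms vanish on
  the range of \<open>1 - q\<close>, where their nonnegative sum, the form of \<open>q\<close>, vanishes.
\<close>

lemma decomposition_null:
  assumes "unital_cstar_algebra B" "two_positive B C \<phi>" "two_copositive B C \<psi>"
    and "q \<in> B" "projection q" "\<phi> q + \<psi> q = q"
  defines "\<zeta> \<equiv> \<lambda>\<xi>. (mat 1 - q) *v \<xi>"
  shows "cinner (\<zeta> \<xi>) (\<phi> q *v \<zeta> \<xi>) = 0 \<and> cinner (\<zeta> \<xi>) (\<psi> q *v \<zeta> \<xi>) = 0"
proof (rule nonneg_Reals_add_eq_0)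
  have "cinner (\<zeta> \<xi>) (\<phi> q *v \<zeta> \<xi>) + cinner (\<zeta> \<xi>) (\<psi> q *v \<zeta> \<xi>) = cinner (\<zeta> \<xi>) (q *v \<zeta> \<xi>)"
    by (simp flip: cinner_add_right matrix_vector_mult_add_rdistrib add: assms(6))
  also have "q *v \<zeta> \<xi> = 0"
    by (simp add: \<zeta>_def matrix_vector_mul_assoc projection_mult_complement assms(5))
  finally show "cinner (\<zeta> \<xi>) (\<phi> q *v \<zeta> \<xi>) + cinner (\<zeta> \<xi>) (\<psi> q *v \<zeta> \<xi>) = 0"
    by (simp add: cinner_def)
qed (rule two_positive_projection_nonneg[OF assms(1,2,4,5)]
       two_copositive_projection_nonneg[OF assms(1,3,4,5)])+

section \<open>Symmetries\<close>

definition spectral_projection :: "complex ^ 'n ^ 'n \<Rightarrow> complex ^ 'n ^ 'n" where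
  "spectral_projection s = (1/2) *\<^sub>R (mat 1 + s)"

lemma symmetry_square: "symmetry s \<Longrightarrow> s ** s = mat 1"
  unfolding symmetry_def selfadjoint_def by metis

lemma projection_spectral_projection:
  assumes "symmetry s"
  shows "projection (spectral_projection s)"
proof -
  have "(mat 1 + s) ** (mat 1 + s) = 2 *\<^sub>R (mat 1 + s)"
    by (simp add: matrix_add_ldistrib matrix_add_rdistrib symmetry_square[OF assms] scaleR_2 add_ac)
  moreover have "hadjoint (r *\<^sub>R A) = r *\<^sub>R hadjoint A" for r and A :: "complex ^ 'a ^ 'a"
    by (simp flip: cscale_of_real add: hadjoint_cscale)
  ultimately show ?thesis
    using assms
    by (simp add: projection_def spectral_projection_def symmetry_def selfadjoint_def hadjoint_add
        hadjoint_mat_1 scaleR_matrix_mult_left scaleR_matrix_mult_right)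
qed

lemma symmetry_eq: "s = 2 *\<^sub>R spectral_projection s - mat 1"
  by (simp add: spectral_projection_def)

lemma spectral_projection_mem:
  "unital_cstar_algebra B \<Longrightarrow> s \<in> B \<Longrightarrow> spectral_projection s \<in> B"
  unfolding spectral_projection_def
  by (rule cstar_scaleR) (auto simp: unital_cstar_algebra_def)

lemma clinear_fixes_spectral_projection:
  assumes "unital_cstar_algebra B" "clinear_between B C \<phi>" "s \<in> B" "\<phi> (mat 1) = mat 1" "\<phi> s = s"
  shows "\<phi> (spectral_projection s) = spectral_projection s"
    and "\<phi> (mat 1 - spectral_projection s) = mat 1 - spectral_projection s"
proof -
  show e: "\<phi> (spectral_projection s) = spectral_projection s"
    unfolding spectral_projection_def using assms
    by (subst clinear_scaleR[OF assms(2)]) (auto simp: clinear_between_def unital_cstar_algebra_def)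
  show "\<phi> (mat 1 - spectral_projection s) = mat 1 - spectral_projection s"
    using assms spectral_projection_mem[OF assms(1,3)]
    by (subst clinear_diff[OF assms(1,2)]) (auto simp: e unital_cstar_algebra_def)
qed

text \<open>
  As \<open>s = e - (1 - e)\<close> for its spectral projections, which \<open>P\<close> fixes together with \<open>s\<close>, the property
  for \<open>s\<close> follows from that for \<open>e\<close>.
\<close>

lemma decomposition_symmetry_module:
  assumes "unital_cstar_algebra B" "clinear_between B C P" "two_positive B C \<phi>" "two_copositive B C \<psi>"
    and sum: "\<And>a. a \<in> B \<Longrightarrow> P a = \<phi> a + \<psi> a"
    and "P (mat 1) = mat 1" "s \<in> B" "symmetry s" "P s = s" "x \<in> B"
  shows "\<phi> (s ** x) = s ** \<phi> x" and "\<psi> (x ** s) = s ** \<psi> x"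
proof -
  define e where "e = spectral_projection s"
  have e: "projection e" "e \<in> B" "mat 1 - e \<in> B" "projection (mat 1 - e)"
    unfolding e_def
    using assms projection_spectral_projection[of s] spectral_projection_mem[of B s]
      cstar_diff[OF assms(1)] projection_complement
    by (auto simp: unital_cstar_algebra_def)
  have fixed: "\<phi> q + \<psi> q = q" if "q \<in> {e, mat 1 - e}" for q
    using that clinear_fixes_spectral_projection[OF assms(1,2,7,6,9)] sum e by (auto simp: e_def)
  have null: "cinner ((mat 1 - q) *v \<xi>) (\<phi> q *v ((mat 1 - q) *v \<xi>)) = 0 \<and>
      cinner ((mat 1 - q) *v \<xi>) (\<psi> q *v ((mat 1 - q) *v \<xi>)) = 0"
    if "q \<in> {e, mat 1 - e}" for q \<xi>
    using decomposition_null[OF assms(1,3,4) _ _ fixed[OF that]] e that by blast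
  have lin: "clinear_between B C \<phi>" "clinear_between B C \<psi>"
    using assms(3,4) by (auto simp: two_positive_def two_copositive_def)
  have mem: "e ** x \<in> B" "x ** e \<in> B" "2 *\<^sub>R (e ** x) \<in> B" "2 *\<^sub>R (x ** e) \<in> B"
    using assms(1,10) e cstar_scaleR[OF assms(1)] by (auto simp: unital_cstar_algebra_def)
  have s: "s = 2 *\<^sub>R e - mat 1"
    unfolding e_def by (rule symmetry_eq)
  have "\<phi> (e ** x) = e ** \<phi> x"
    using null by (intro two_positive_left_module[OF assms(1,3)] e assms) auto
  thus "\<phi> (s ** x) = s ** \<phi> x"
    using mem assms(10)
    by (simp add: s matrix_diff_rdistrib scaleR_matrix_mult_left clinear_diff[OF assms(1) lin(1)]
        clinear_scaleR[OF lin(1)])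
  have "\<psi> (x ** e) = e ** \<psi> x"
    using null by (intro two_copositive_left_module[OF assms(1,4)] e assms) auto
  thus "\<psi> (x ** s) = s ** \<psi> x"
    using mem assms(10)
    by (simp add: s matrix_diff_rdistrib matrix_diff_ldistrib scaleR_matrix_mult_left
        scaleR_matrix_mult_right clinear_diff[OF assms(1) lin(2)] clinear_scaleR[OF lin(2)])
qed

section \<open>Trace preserving maps and fixed symmetries\<close>

lemma trace_projection_nonneg:
  assumes "positive_op a" "projection e"
  shows "trace (a ** e) \<in> \<real>\<^sub>\<ge>\<^sub>0"
proof -
  have "trace (a ** e) = trace (a ** (e ** e))"
    using assms(2) by (simp add: projection_def)
  also have "\<dots> = trace ((a ** e) ** e)"
    by (simp only: matrix_mul_assoc)
  also have "\<dots> = trace (e ** (a ** e))"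
    by (rule trace_mul_sym)
  also have "\<dots> = trace (hadjoint e ** a ** e)"
    using assms(2) by (simp add: projection_def matrix_mul_assoc)
  finally show ?thesis using trace_compression_nonneg[OF assms(1)] by metis
qed

text \<open>
  The functional \<open>y \<mapsto> Tr (P y p)\<close> is positive and vanishes at \<open>q\<close>.
\<close>

lemma trace_annihilates:
  assumes "unital_cstar_algebra B" "positive_map B B P"
    and "q \<in> B" "projection q" "P q = q" "projection p" "q ** p = 0" "x \<in> B"
  shows "trace (P (q ** x) ** p) = 0"
proof (rule sesquilinear_nonneg_imp_0)
  fix c
  define a where "a = cscale c q + x"
  have mem: "cscale c q \<in> B" "a \<in> B" "q ** x \<in> B" "hadjoint x ** q \<in> B" "hadjoint x ** x \<in> B"
    using assms(1,3,8) by (auto simp: unital_cstar_algebra_def a_def)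
  have add: "\<And>y z. y \<in> B \<Longrightarrow> z \<in> B \<Longrightarrow> P (y + z) = P y + P z"
    and hom: "\<And>d y. y \<in> B \<Longrightarrow> P (cscale d y) = cscale d (P y)"
    using assms(2) by (auto simp: positive_map_def clinear_between_def)
  have closed: "\<And>y z. y \<in> B \<Longrightarrow> z \<in> B \<Longrightarrow> y + z \<in> B" "\<And>d y. y \<in> B \<Longrightarrow> cscale d y \<in> B"
    using assms(1) by (auto simp: unital_cstar_algebra_def)
  have "hadjoint a ** a = cscale (cnj c * c) q + cscale c (hadjoint x ** q)
      + cscale (cnj c) (q ** x) + hadjoint x ** x"
    using assms(4)
    by (simp add: a_def projection_def hadjoint_add hadjoint_cscale matrix_add_ldistrib
        matrix_add_rdistrib cscale_mult_left cscale_mult_right cscale_cscale cscale_add mult.commute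
        add_ac)
  hence "trace (P (hadjoint a ** a) ** p) = c * trace (P (hadjoint x ** q) ** p)
      + cnj c * trace (P (q ** x) ** p) + trace (P (hadjoint x ** x) ** p)"
    using mem assms(3,5,7)
    by (simp add: add hom closed matrix_add_rdistrib cscale_mult_left trace_add trace_cscale trace_zero)
  moreover have "trace (P (hadjoint a ** a) ** p) \<in> \<real>\<^sub>\<ge>\<^sub>0"
    using assms(1,2,6) mem(2) positive_gram[of a]
    by (intro trace_projection_nonneg) (auto simp: positive_map_def unital_cstar_algebra_def)
  ultimately show "c * trace (P (hadjoint x ** q) ** p) + cnj c * trace (P (q ** x) ** p)
      + trace (P (hadjoint x ** x) ** p) \<in> \<real>\<^sub>\<ge>\<^sub>0"
    by simp
qed

text \<open>
  Put \<open>f = 1 - e\<close>. By the previous lemma \<open>Tr (P (f x) e) = 0\<close> and \<open>Tr (P (e x) f) = 0\<close>, so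
  \<open>Tr (P x e) = Tr (P (e x) e) = Tr (P (e x)) = Tr (e x) = Tr (x e)\<close>.
\<close>

lemma trace_fixed_projection:
  assumes "unital_cstar_algebra B" "positive_map B B P"
    and tr: "\<And>a. a \<in> B \<Longrightarrow> trace (P a) = trace a"
    and "e \<in> B" "projection e" "P e = e" "P (mat 1 - e) = mat 1 - e" "x \<in> B"
  shows "trace (P x ** e) = trace (x ** e)"
proof -
  let ?f = "mat 1 - e"
  have mem: "?f \<in> B" "e ** x \<in> B" "?f ** x \<in> B"
    using assms(1,4,8) cstar_diff[OF assms(1)] by (simp_all add: unital_cstar_algebra_def)
  have fe: "?f ** e = 0"
    using assms(5) by (simp add: projection_def matrix_diff_rdistrib)
  have "P x = P (e ** x + ?f ** x)"
    by (simp add: matrix_diff_rdistrib)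
  also have "\<dots> = P (e ** x) + P (?f ** x)"
    using assms(2) mem by (simp add: positive_map_def clinear_between_def)
  finally have "trace (P x ** e) = trace (P (e ** x) ** e) + trace (P (?f ** x) ** e)"
    by (simp add: matrix_add_rdistrib trace_add)
  also have "trace (P (?f ** x) ** e) = 0"
    by (rule trace_annihilates[OF assms(1,2) mem(1) projection_complement assms(7,5) fe])
       (use assms in auto)
  also have "trace (P (e ** x) ** e) + 0 = trace (P (e ** x) ** e) + trace (P (e ** x) ** ?f)"
    using trace_annihilates[OF assms(1,2,4,5,6) projection_complement projection_mult_complement]
      assms by simp
  also have "\<dots> = trace (P (e ** x))"
    by (simp add: matrix_diff_ldistrib trace_sub)
  also have "\<dots> = trace (x ** e)"
    using tr[OF mem(2)] trace_mul_sym[of e x] by simp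
  finally show ?thesis .
qed

lemma trace_fixed_symmetry:
  assumes "unital_cstar_algebra B" "positive_map B B P"
    and tr: "\<And>a. a \<in> B \<Longrightarrow> trace (P a) = trace a"
    and "P (mat 1) = mat 1" "s \<in> B" "symmetry s" "P s = s" "x \<in> B"
  shows "trace (P x ** s) = trace (x ** s)"
proof -
  let ?e = "spectral_projection s"
  have "clinear_between B B P" using assms(2) by (simp add: positive_map_def)
  note fixed = clinear_fixes_spectral_projection[OF assms(1) this assms(5,4,7)]
  have "trace (P x ** ?e) = trace (x ** ?e)"
    by (rule trace_fixed_projection[OF assms(1,2) tr spectral_projection_mem
          projection_spectral_projection fixed]) (use assms in auto)
  moreover have "trace (y ** s) = 2 * trace (y ** ?e) - trace y" for y
  proof -
    have "y ** s = cscale (of_real 2) (y ** ?e) - y"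
      by (subst symmetry_eq) (simp add: matrix_diff_ldistrib scaleR_matrix_mult_right cscale_of_real
        del: of_real_numeral)
    thus ?thesis by (simp add: trace_sub trace_cscale)
  qed
  ultimately show ?thesis using tr[OF assms(8)] by simp
qed

section \<open>Products in a spin system\<close>

lemma trace_eq_0_if_anticommutes:
  assumes "x ** u = - (u ** x)" "u ** u = (mat 1 :: complex ^ 'n ^ 'n)"
  shows "trace x = 0"
proof -
  have "trace x = trace ((x ** u) ** u)"
    by (simp add: assms(2) flip: matrix_mul_assoc)
  also have "\<dots> = trace (u ** (x ** u))"
    by (rule trace_mul_sym)
  also have "\<dots> = - trace ((u ** u) ** x)"
    by (simp add: assms(1) minus_eq_cscale cscale_mult_right trace_cscale matrix_mul_assoc)
  finally show ?thesis by (simp add: assms(2))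
qed

text \<open>
  Products in a spin system commute or anticommute with its members; the real factors \<open>c\<close> and \<open>d\<close>
  are signs, so that longer words are handled by multiplying signs.
\<close>

lemma mult_commute_up_to_sign:
  fixes a b u :: "complex ^ 'n ^ 'n"
  assumes "a ** u = c *\<^sub>R (u ** a)" "b ** u = d *\<^sub>R (u ** b)"
  shows "(a ** b) ** u = (c * d) *\<^sub>R (u ** (a ** b))"
proof -
  have "(a ** b) ** u = d *\<^sub>R ((a ** u) ** b)"
    by (simp add: assms(2) scaleR_matrix_mult_right flip: matrix_mul_assoc)
  also have "\<dots> = (c * d) *\<^sub>R (u ** (a ** b))"
    by (simp add: assms(1) scaleR_matrix_mult_left mult.commute matrix_mul_assoc)
  finally show ?thesis .
qed


lemma spin_system_anticommute:
  assumes "spin_system S" "s \<in> S" "t \<in> S" "s \<noteq> t"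
  shows "s ** t = - (t ** s)"
proof -
  have "jordan_prod s t = 0"
    using assms by (auto simp: spin_system_def)
  thus ?thesis
    by (simp add: jordan_prod_def eq_neg_iff_add_eq_0)
qed

text \<open>
  The trace of \<open>y\<close> vanishes once some symmetry anticommutes with \<open>y\<close>. For \<open>w\<close> this is \<open>s1\<close>, which
  anticommutes with three factors. For \<open>w t\<close> it is \<open>t\<close> if \<open>t\<close> is among the factors (three sign
  changes), and otherwise the additional \<open>u\<close> (five sign changes).
\<close>

lemma spin_system_four_product_trace:
  assumes S: "spin_system S" and st: "{s1, s2, s3, s4} \<subseteq> S" "distinct [s1, s2, s3, s4]"
    and t: "t \<in> S" and u: "u \<in> S" "u \<notin> {s1, s2, s3, s4, t}"
  defines "w \<equiv> s1 ** (s2 ** (s3 ** s4))"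
  shows "trace w = 0" and "trace (w ** t) = 0"
proof -
  define \<epsilon> :: "complex ^ 'a ^ 'a \<Rightarrow> complex ^ 'a ^ 'a \<Rightarrow> real" where
    "\<epsilon> a b = (if a = b then 1 else - 1)" for a b
  have sq: "a ** a = mat 1" if "a \<in> S" for a
    using S that symmetry_square by (auto simp: spin_system_def)
  have sign: "a ** b = \<epsilon> a b *\<^sub>R (b ** a)" if "a \<in> S" "b \<in> S" for a b
    using spin_system_anticommute[OF S that] by (auto simp: \<epsilon>_def)
  have w: "w ** v = (\<epsilon> s1 v * (\<epsilon> s2 v * (\<epsilon> s3 v * \<epsilon> s4 v))) *\<^sub>R (v ** w)" if "v \<in> S" for v
    unfolding w_def using st that by (intro mult_commute_up_to_sign sign) auto
  have wt: "(w ** t) ** v = (\<epsilon> s1 v * (\<epsilon> s2 v * (\<epsilon> s3 v * \<epsilon> s4 v)) * \<epsilon> t v) *\<^sub>R (v ** (w ** t))"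
    if "v \<in> S" for v
    by (intro mult_commute_up_to_sign w sign that t)
  show "trace w = 0"
    using w[of s1] sq[of s1] st by (intro trace_eq_0_if_anticommutes[of _ s1]) (auto simp: \<epsilon>_def)
  show "trace (w ** t) = 0"
  proof (cases "t \<in> {s1, s2, s3, s4}")
    case True
    thus ?thesis
      using wt[of t] sq[of t] t st
      by (intro trace_eq_0_if_anticommutes[of _ t]) (auto simp: \<epsilon>_def)
  next
    case False
    thus ?thesis
      using wt[of u] sq[of u] u
      by (intro trace_eq_0_if_anticommutes[of _ u]) (auto simp: \<epsilon>_def)
  qed
qed

lemma spin_system_four_product_reverse:
  assumes S: "spin_system S" and st: "{s1, s2, s3, s4} \<subseteq> S" "distinct [s1, s2, s3, s4]"
  shows "s4 ** (s3 ** (s2 ** s1)) = s1 ** (s2 ** (s3 ** s4))"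
proof -
  have anti: "a ** b = (- 1) *\<^sub>R (b ** a)" if "a \<in> S" "b \<in> S" "a \<noteq> b" for a b
    using spin_system_anticommute[OF S that] by simp
  have "s2 ** s1 = - (s1 ** s2)"
    using anti[of s2 s1] st by auto
  hence "s4 ** (s3 ** (s2 ** s1)) = - ((s4 ** s3) ** (s1 ** s2))"
    by (simp add: minus_eq_cscale cscale_mult_right matrix_mul_assoc)
  also have "(s4 ** s3) ** (s1 ** s2) = ((s4 ** s3) ** s1) ** s2"
    by (simp only: matrix_mul_assoc)
  also have "(s4 ** s3) ** s1 = (- 1 * - 1) *\<^sub>R (s1 ** (s4 ** s3))"
    using st by (intro mult_commute_up_to_sign anti) auto
  also have "((- 1 * - 1) *\<^sub>R (s1 ** (s4 ** s3))) ** s2 = s1 ** ((s4 ** s3) ** s2)"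
    by (simp add: matrix_mul_assoc)
  also have "(s4 ** s3) ** s2 = (- 1 * - 1) *\<^sub>R (s2 ** (s4 ** s3))"
    using st by (intro mult_commute_up_to_sign anti) auto
  also have "s4 ** s3 = - (s3 ** s4)"
    using anti[of s4 s3] st by auto
  finally show ?thesis
    by (simp add: minus_eq_cscale cscale_mult_right cscale_cscale cscale_1)
qed

lemma spin_factor_selfadjoint:
  assumes "spin_system S" "y \<in> span (insert (mat 1) S)"
  shows "hadjoint y = y"
  using assms(2)
proof (induction rule: span_induct_alt)
  case base
  show ?case by (simp add: hadjoint_def vec_eq_iff)
next
  case (step c x y)
  have "hadjoint x = x"
    using step(1) assms(1) by (auto simp: spin_system_def symmetry_def selfadjoint_def hadjoint_mat_1)
  moreover have "hadjoint (c *\<^sub>R x) = c *\<^sub>R hadjoint x"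
    by (simp flip: cscale_of_real add: hadjoint_cscale)
  ultimately show ?case
    using step(2) by (simp add: hadjoint_add)
qed

lemma trace_orthogonal_span:
  fixes x :: "complex ^ 'n ^ 'n"
  assumes "\<And>y. y \<in> S \<Longrightarrow> trace (x ** y) = 0" "y \<in> span S"
  shows "trace (x ** y) = 0"
proof -
  have "linear (\<lambda>y. trace (x ** y))"
  proof (rule linearI)
    show "trace (x ** (r *\<^sub>R y)) = r *\<^sub>R trace (x ** y)" for r y
      by (simp add: scaleR_matrix_mult_right) (simp add: trace_def scaleR_sum_right)
  qed (simp add: matrix_add_ldistrib trace_add)
  from linear_eq_0_on_span[OF this assms(1) assms(2)] show ?thesis by simp
qed

text \<open>
  The spin system may be given as an infinite set, so the dimension is used through choosing new
  elements instead of through a cardinality.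
\<close>

lemma spin_system_fresh:
  assumes "dim (span (insert (mat 1) S)) > 6" "length xs \<le> 5"
  shows "\<exists>s\<in>S. s \<notin> set xs"
proof (rule ccontr)
  assume "\<not> ?thesis"
  hence "dim (insert (mat 1) S) \<le> card (set (mat 1 # xs))"
    by (intro dim_le_card) (auto intro: span_base)
  thus False using assms card_length[of "mat 1 # xs"] by simp
qed

section \<open>Atomicity\<close>

theorem mainTheorem3:
  fixes B :: "(complex ^ 'n ^ 'n) set"
    and P :: "complex ^ 'n ^ 'n \<Rightarrow> complex ^ 'n ^ 'n"
  assumes "unital_cstar_algebra B"
    and "projection_map B P"
    and "\<And>a. a \<in> B \<Longrightarrow> trace (P a) = trace a"
    and "spin_factor (P ` sa_part B)"
    and "dim (P ` sa_part B) > 6"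
  shows "atomic_map B B P"
proof -
  have P: "positive_map B B P" "clinear_between B B P" "P (mat 1) = mat 1"
    and idem: "\<And>a. a \<in> B \<Longrightarrow> P (P a) = P a" and PB: "\<And>a. a \<in> B \<Longrightarrow> P a \<in> B"
    using assms(2) by (auto simp: projection_map_def positive_map_def clinear_between_def)
  obtain S where S: "spin_system S" and V: "P ` sa_part B = span (insert (mat 1) S)"
    using assms(4) by (auto simp: spin_factor_def)
  have SV: "s \<in> P ` sa_part B" if "s \<in> S" for s
    unfolding V using that by (auto intro: span_base)
  have SB: "s \<in> B" and Ps: "P s = s" and sym: "symmetry s" if "s \<in> S" for s
    using SV[OF that] S that idem PB by (auto simp: sa_part_def spin_system_def)
  have fresh: "\<exists>s\<in>S. s \<notin> set xs" if "length xs \<le> 5" for xs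
    using spin_system_fresh[OF _ that] assms(5) V by metis
  obtain s1 where s1: "s1 \<in> S" using fresh[of "[]"] by auto
  obtain s2 where s2: "s2 \<in> S" "s2 \<notin> {s1}" using fresh[of "[s1]"] by auto
  obtain s3 where s3: "s3 \<in> S" "s3 \<notin> {s1, s2}"
    using fresh[of "[s1, s2]"] by auto
  obtain s4 where s4: "s4 \<in> S" "s4 \<notin> {s1, s2, s3}"
    using fresh[of "[s1, s2, s3]"] by auto
  have st: "{s1, s2, s3, s4} \<subseteq> S" "distinct [s1, s2, s3, s4]"
    using s1 s2 s3 s4 by auto
  define w where "w = s1 ** (s2 ** (s3 ** s4))"
  have mult: "\<And>a b. a \<in> B \<Longrightarrow> b \<in> B \<Longrightarrow> a ** b \<in> B" and one: "mat 1 \<in> B"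
    using assms(1) by (auto simp: unital_cstar_algebra_def)
  have sB: "s1 \<in> B" "s2 \<in> B" "s3 \<in> B" "s4 \<in> B" "w \<in> B"
    unfolding w_def using st SB mult by auto
  have tr_w: "trace w = 0 \<and> trace (w ** t) = 0" if "t \<in> S" for t
  proof -
    obtain u where "u \<in> S" "u \<notin> {s1, s2, s3, s4, t}"
      using fresh[of "[s1, s2, s3, s4, t]"] by auto
    from spin_system_four_product_trace[OF S st that this] show ?thesis
      by (simp add: w_def)
  qed
  \<comment> \<open>The adjoint reverses the word, so \<open>w\<close> is self-adjoint and \<open>P w\<close> lies in the spin factor.\<close>
  have "hadjoint w = s4 ** (s3 ** (s2 ** s1))"
    using sym st by (simp add: w_def hadjoint_mult symmetry_def selfadjoint_def matrix_mul_assoc)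
  hence "w \<in> sa_part B"
    using sB(5) spin_system_four_product_reverse[OF S st]
    by (simp add: w_def sa_part_def selfadjoint_def)
  hence PwV: "P w \<in> span (insert (mat 1) S)"
    using V by blast
  have "trace (P w ** P w) = 0"
  proof (rule trace_orthogonal_span[OF _ PwV])
    show "trace (P w ** t) = 0" if "t \<in> insert (mat 1) S" for t
      using that tr_w s1 assms(3)[OF sB(5)]
        trace_fixed_symmetry[OF assms(1) P(1) assms(3) P(3) SB sym Ps sB(5)] by auto
  qed
  hence Pw: "P w = 0"
    using spin_factor_selfadjoint[OF S PwV] by (intro trace_gram_eq_0) simp
  have "False" if \<phi>: "two_positive B B \<phi>" and \<psi>: "two_copositive B B \<psi>"
    and sum: "\<And>a. a \<in> B \<Longrightarrow> P a = \<phi> a + \<psi> a" for \<phi> \<psi>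
  proof -
    have L: "\<phi> (s ** x) = s ** \<phi> x" and R: "\<psi> (x ** s) = s ** \<psi> x"
      if "s \<in> S" "x \<in> B" for s x
      by (rule decomposition_symmetry_module[OF assms(1) P(2) \<phi> \<psi> sum P(3)];
          use that SB sym Ps in simp)+
    have S4: "s1 \<in> S" "s2 \<in> S" "s3 \<in> S" "s4 \<in> S"
      using st by auto
    have "\<phi> w = s1 ** (s2 ** (s3 ** (s4 ** \<phi> (mat 1))))"
      using L[of s4 "mat 1"] by (simp add: w_def L S4 sB mult one)
    moreover have "\<psi> w = \<psi> (((s1 ** s2) ** s3) ** s4)"
      by (simp only: w_def matrix_mul_assoc)
    hence "\<psi> w = s4 ** (s3 ** (s2 ** (s1 ** \<psi> (mat 1))))"
      using R[of s1 "mat 1"] by (simp add: R S4 sB mult one)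
    hence "\<psi> w = (s4 ** (s3 ** (s2 ** s1))) ** \<psi> (mat 1)"
      by (simp only: matrix_mul_assoc)
    hence "\<psi> w = s1 ** (s2 ** (s3 ** (s4 ** \<psi> (mat 1))))"
      by (simp only: spin_system_four_product_reverse[OF S st]) (simp only: matrix_mul_assoc)
    ultimately have "P w = s1 ** (s2 ** (s3 ** (s4 ** P (mat 1))))"
      by (simp add: sum sB one matrix_add_ldistrib)
    hence zero: "s1 ** (s2 ** (s3 ** s4)) = 0"
      using Pw P(3) by simp
    have cancel: "a = 0" if "s ** a = 0" "s \<in> S" for s a
    proof -
      have "a = (s ** s) ** a"
        using symmetry_square[OF sym[OF that(2)]] by simp
      also have "\<dots> = s ** (s ** a)"
        by (simp only: matrix_mul_assoc)
      finally show ?thesis using that(1) by simp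
    qed
    have "s4 = 0"
      using zero cancel S4 by blast
    hence "mat 1 = (0 :: complex ^ 'n ^ 'n)"
      using symmetry_square[OF sym[OF S4(4)]] by simp
    thus False
      by (simp add: mat_def vec_eq_iff) (metis zero_neq_one)
  qed
  thus ?thesis
    using P(1) unfolding atomic_map_def by blast
qed

end
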